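(* Let $m\ge 2$ and let $L_m=\langle a,t \mid a^m,\ [t^{i}at^{-i},t^{j}at^{-j}],\ i,j\in\mathbb{Z}\rangle$. Then $L_m$ has no regular language of geodesics with respect to the generating set $\{a,t\}$.
   Context: $L_m$ is the lamplighter group, i.e. the wreath product $\mathbb{Z}_m\wr\mathbb{Z}$, where $a$ generates $\mathbb{Z}_m$ and $t$ generates $\mathbb{Z}$. For a group $G$ with finite generating set $X$, words are finite strings over the alphabet $X\cup X^{-1}$ (as a subset of $G$); a word is geodesic if its length equals the word length (with respect to $X$) of the element of $G$ it represents. A language of geodesics for $G$ with respect to $X$ is a set of geodesic words that contains at least one representative of each element of $G$. A language is regular if it is accepted by a finite state automaton. *)

theory Defs
  imports "HOL-Algebra.Generated_Groups"
begin

text \<open>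
  The pair \<open>(x, True)\<close> stands for the generator \<open>x\<close>, and \<open>(x, False)\<close> for its formal inverse.
  The generators are all elements of the type \<open>'g\<close>.
\<close>

type_synonym 'g gword = "('g \<times> bool) list"

definition inv_word :: "'g gword \<Rightarrow> 'g gword" where
  "inv_word w = rev (map (\<lambda>(x, b). (x, \<not> b)) w)"

definition comm_word :: "'g gword \<Rightarrow> 'g gword \<Rightarrow> 'g gword" where
  "comm_word u v = u @ v @ inv_word u @ inv_word v"

definition gen_pow :: "'g \<Rightarrow> int \<Rightarrow> 'g gword" where
  "gen_pow x i = replicate (nat \<bar>i\<bar>) (x, 0 \<le> i)"

inductive pres_eq :: "'g gword set \<Rightarrow> 'g gword \<Rightarrow> 'g gword \<Rightarrow> bool"
  for R :: "'g gword set" where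
  refl: "pres_eq R u u"
| sym: "pres_eq R u v \<Longrightarrow> pres_eq R v u"
| trans: "pres_eq R u v \<Longrightarrow> pres_eq R v w \<Longrightarrow> pres_eq R u w"
| cancel: "pres_eq R (u @ [(x, b), (x, \<not> b)] @ v) (u @ v)"
| relator: "r \<in> R \<Longrightarrow> pres_eq R (u @ r @ v) (u @ v)"

definition pres_class :: "'g gword set \<Rightarrow> 'g gword \<Rightarrow> 'g gword set" where
  "pres_class R u = {v. pres_eq R u v}"

definition presented_group :: "'g gword set \<Rightarrow> 'g gword set monoid" where
  "presented_group R =
    \<lparr> carrier = range (pres_class R),
      monoid.mult = (\<lambda>A B. \<Union>u\<in>A. \<Union>v\<in>B. pres_class R (u @ v)),
      one = pres_class R [] \<rparr>"

lemma pres_eq_context: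
  assumes "pres_eq R u v"
  shows "pres_eq R (p @ u @ q) (p @ v @ q)"
  using assms
proof (induction rule: pres_eq.induct)
  case (cancel u x b v)
  show ?case using pres_eq.cancel[of R "p @ u" x b "v @ q"] by simp
next
  case (relator r u v)
  then show ?case using pres_eq.relator[of r R "p @ u" "v @ q"] by simp
qed (rule pres_eq.refl, erule pres_eq.sym, erule pres_eq.trans)

lemma pres_eq_append:
  assumes "pres_eq R u u'" "pres_eq R v v'"
  shows "pres_eq R (u @ v) (u' @ v')"
proof (rule pres_eq.trans)
  show "pres_eq R (u @ v) (u' @ v)"
    using pres_eq_context[OF assms(1), of "[]" v] by simp
  show "pres_eq R (u' @ v) (u' @ v')"
    using pres_eq_context[OF assms(2), of u' "[]"] by simp
qed

lemma pres_class_eq_iff: "pres_class R u = pres_class R v \<longleftrightarrow> pres_eq R u v"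
proof
  assume "pres_class R u = pres_class R v"
  then have "v \<in> pres_class R u"
    by (simp add: pres_class_def pres_eq.refl)
  then show "pres_eq R u v"
    by (simp add: pres_class_def)
next
  assume "pres_eq R u v"
  then show "pres_class R u = pres_class R v"
    unfolding pres_class_def by (intro Collect_cong iffI) (erule (1) pres_eq.trans[OF pres_eq.sym] pres_eq.trans)+
qed

lemma presented_group_mult:
  "pres_class R u \<otimes>\<^bsub>presented_group R\<^esub> pres_class R v = pres_class R (u @ v)"
proof -
  have "pres_class R (u' @ v') = pres_class R (u @ v)"
    if "u' \<in> pres_class R u" "v' \<in> pres_class R v" for u' v'
    unfolding pres_class_eq_iff
    using that by (intro pres_eq_append pres_eq.sym[of R u] pres_eq.sym[of R v])
      (simp_all add: pres_class_def)
  moreover have "u \<in> pres_class R u" "v \<in> pres_class R v"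
    by (simp_all add: pres_class_def pres_eq.refl)
  ultimately have "(\<Union>u'\<in>pres_class R u. \<Union>v'\<in>pres_class R v. pres_class R (u' @ v')) = pres_class R (u @ v)"
    by blast
  then show ?thesis
    by (simp add: presented_group_def)
qed

lemma presented_group_one: "\<one>\<^bsub>presented_group R\<^esub> = pres_class R []"
  by (simp add: presented_group_def)

lemma presented_group_carrier: "carrier (presented_group R) = range (pres_class R)"
  by (simp add: presented_group_def)

lemma pres_eq_inv_word_left: "pres_eq R (inv_word w @ w) []"
proof (induction w)
  case Nil
  show ?case by (simp add: inv_word_def pres_eq.refl)
next
  case (Cons y w)
  obtain x b where y: "y = (x, b)" by (cases y)
  have "pres_eq R (inv_word (y # w) @ y # w) (inv_word w @ w)"
    using pres_eq.cancel[of R "inv_word w" x "\<not> b" w] by (simp add: inv_word_def y)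
  then show ?case using Cons.IH by (rule pres_eq.trans)
qed

lemma group_presented_group: "group (presented_group R)"
proof (rule groupI)
  fix x assume "x \<in> carrier (presented_group R)"
  then obtain u where u: "x = pres_class R u"
    by (auto simp: presented_group_carrier)
  have "pres_class R (inv_word u) \<otimes>\<^bsub>presented_group R\<^esub> x = \<one>\<^bsub>presented_group R\<^esub>"
    by (simp add: u presented_group_mult presented_group_one pres_class_eq_iff
        pres_eq_inv_word_left)
  then show "\<exists>y\<in>carrier (presented_group R).
      y \<otimes>\<^bsub>presented_group R\<^esub> x = \<one>\<^bsub>presented_group R\<^esub>"
    by (auto simp: presented_group_carrier)
qed (auto simp: presented_group_carrier presented_group_one presented_group_mult)

datatype lamp_gen = Gen_a | Gen_t

definition lamp_conj :: "int \<Rightarrow> lamp_gen gword" where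
  "lamp_conj i = gen_pow Gen_t i @ gen_pow Gen_a 1 @ gen_pow Gen_t (- i)"

definition lamp_relators :: "nat \<Rightarrow> lamp_gen gword set" where
  "lamp_relators m =
    insert (gen_pow Gen_a (int m)) {comm_word (lamp_conj i) (lamp_conj j) | i j. True}"

definition lamplighter :: "nat \<Rightarrow> lamp_gen gword set monoid" where
  "lamplighter m = presented_group (lamp_relators m)"

definition lamp_a :: "nat \<Rightarrow> lamp_gen gword set" where
  "lamp_a m = pres_class (lamp_relators m) (gen_pow Gen_a 1)"

definition lamp_t :: "nat \<Rightarrow> lamp_gen gword set" where
  "lamp_t m = pres_class (lamp_relators m) (gen_pow Gen_t 1)"

lemma group_lamplighter: "group (lamplighter m)"
  by (simp add: lamplighter_def group_presented_group)

lemma lamplighter_generated: "generate (lamplighter m) {lamp_a m, lamp_t m} = carrier (lamplighter m)"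
proof -
  interpret L: group "lamplighter m" by (rule group_lamplighter)
  let ?R = "lamp_relators m"
  let ?X = "{lamp_a m, lamp_t m}"
  have carr: "pres_class ?R w \<in> carrier (lamplighter m)" for w
    by (simp add: lamplighter_def presented_group_carrier)
  have sub: "?X \<subseteq> carrier (lamplighter m)"
    using carr by (simp add: lamp_a_def lamp_t_def)
  have letter: "pres_class ?R [(g, b)] \<in> generate (lamplighter m) ?X" for g b
  proof -
    have pos: "pres_class ?R [(g, True)] \<in> ?X"
      by (cases g) (simp_all add: lamp_a_def lamp_t_def gen_pow_def)
    have "pres_class ?R [(g, False)] \<otimes>\<^bsub>lamplighter m\<^esub> pres_class ?R [(g, True)]
        = \<one>\<^bsub>lamplighter m\<^esub>"
      using pres_eq.cancel[of ?R "[]" g False "[]"]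
      by (simp add: lamplighter_def presented_group_mult presented_group_one pres_class_eq_iff)
    then have neg: "inv\<^bsub>lamplighter m\<^esub> pres_class ?R [(g, True)] = pres_class ?R [(g, False)]"
      by (rule L.inv_equality[OF _ carr carr])
    show ?thesis
    proof (cases b)
      case True
      then show ?thesis using generate.incl[OF pos] by simp
    next
      case False
      then show ?thesis using generate.inv[OF pos, of "lamplighter m"] by (simp only: neg)
    qed
  qed
  have "pres_class ?R w \<in> generate (lamplighter m) ?X" for w
  proof (induction w)
    case Nil
    show ?case
      using generate.one[of "lamplighter m" ?X] by (simp add: lamplighter_def presented_group_one)
  next
    case (Cons y w)
    obtain g b where y: "y = (g, b)" by (cases y)
    have "pres_class ?R (y # w) = pres_class ?R [(g, b)] \<otimes>\<^bsub>lamplighter m\<^esub> pres_class ?R w"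
      by (simp add: y lamplighter_def presented_group_mult)
    then show ?case using generate.eng[OF letter Cons.IH] by simp
  qed
  then have "carrier (lamplighter m) \<subseteq> generate (lamplighter m) ?X"
    by (simp add: lamplighter_def presented_group_carrier image_subset_iff)
  then show ?thesis
    using L.generate_incl[OF sub] by (rule subset_antisym[rotated])
qed

text \<open>
  The letters are elements of the group itself, so that a generator which is its own inverse
  contributes a single letter.
\<close>

definition sym_alphabet :: "('a, 'b) monoid_scheme \<Rightarrow> 'a set \<Rightarrow> 'a set" where
  "sym_alphabet G X = X \<union> (\<lambda>x. inv\<^bsub>G\<^esub> x) ` X"

definition word_value :: "('a, 'b) monoid_scheme \<Rightarrow> 'a list \<Rightarrow> 'a" where
  "word_value G w = foldr (\<lambda>x y. x \<otimes>\<^bsub>G\<^esub> y) w \<one>\<^bsub>G\<^esub>"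

definition word_length :: "('a, 'b) monoid_scheme \<Rightarrow> 'a set \<Rightarrow> 'a \<Rightarrow> nat" where
  "word_length G X g =
    (LEAST n. \<exists>w \<in> lists (sym_alphabet G X). word_value G w = g \<and> length w = n)"

definition geodesic_word :: "('a, 'b) monoid_scheme \<Rightarrow> 'a set \<Rightarrow> 'a list \<Rightarrow> bool" where
  "geodesic_word G X w \<longleftrightarrow>
    w \<in> lists (sym_alphabet G X) \<and> length w = word_length G X (word_value G w)"

definition language_of_geodesics :: "('a, 'b) monoid_scheme \<Rightarrow> 'a set \<Rightarrow> 'a list set \<Rightarrow> bool" where
  "language_of_geodesics G X L \<longleftrightarrow>
    (\<forall>w\<in>L. geodesic_word G X w) \<and> (\<forall>g\<in>carrier G. \<exists>w\<in>L. word_value G w = g)"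

record ('s, 'l) automaton =
  states :: "'s set"
  start :: 's
  accepting :: "'s set"
  step :: "'s \<Rightarrow> 'l \<Rightarrow> 's"

definition finite_state_automaton :: "'l set \<Rightarrow> ('s, 'l) automaton \<Rightarrow> bool" where
  "finite_state_automaton A M \<longleftrightarrow>
    finite A \<and> finite (states M) \<and> start M \<in> states M \<and> accepting M \<subseteq> states M \<and>
    (\<forall>s\<in>states M. \<forall>x\<in>A. step M s x \<in> states M)"

definition accepted_language :: "'l set \<Rightarrow> ('s, 'l) automaton \<Rightarrow> 'l list set" where
  "accepted_language A M = {w \<in> lists A. foldl (step M) (start M) w \<in> accepting M}"

text \<open>Any finite set of states can be renamed to a set of natural numbers.\<close>

definition regular_language :: "'l set \<Rightarrow> 'l list set \<Rightarrow> bool" where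
  "regular_language A L \<longleftrightarrow>
    (\<exists>M :: (nat, 'l) automaton. finite_state_automaton A M \<and> L = accepted_language A M)"

end

theory Submission
  imports Defs
begin

text \<open>
  Let \<open>g\<close> have lamps lit exactly at the positions \<open>\<plusminus>n\<close> and the cursor at the origin. A walk of the
  lamplighter realising \<open>g\<close> makes at least two button presses and \<open>4n\<close> moves, and if it makes
  no more than that it begins with \<open>t\<^sup>n\<close> or \<open>t\<^sup>-\<^sup>n\<close>. If \<open>n\<close> is the number of states of an automaton
  accepting geodesics only, the initial block, say \<open>t\<^sup>n\<close>, of an accepted word for \<open>g\<close> can be pumped,
  so words of length \<open>k + 4n + 2\<close> for \<open>t\<^sup>k g\<close> with \<open>k \<ge> n\<close> are accepted. They are not geodesic:
  \<open>t\<^sup>k g\<close> is also represented by \<open>t\<^sup>k t\<^sup>-\<^sup>n a t\<^sup>2\<^sup>n a t\<^sup>-\<^sup>n\<close>, of length \<open>k + 2n + 2\<close> after cancellation.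
\<close>

section \<open>Presented groups\<close>

lemma inv_word_append: "inv_word (u @ v) = inv_word v @ inv_word u"
  by (simp add: inv_word_def)

lemma inv_word_replicate: "inv_word (replicate n (x, b)) = replicate n (x, \<not> b)"
  by (simp add: inv_word_def)

lemma pres_eq_replicate_cancel: "pres_eq R (replicate n (x, b) @ replicate n (x, \<not> b)) []"
  using pres_eq_inv_word_left[of R "replicate n (x, \<not> b)"] by (simp add: inv_word_replicate)

text \<open>Appending the trivial word \<open>inv_word (v @ u) @ (v @ u)\<close> to
  \<open>u @ v\<close> makes the relator \<open>comm_word u v\<close> appear in front of
  \<open>v @ u\<close>, where it can be deleted.\<close>

lemma pres_eq_commute:
  assumes "comm_word u v \<in> R"
  shows "pres_eq R (u @ v) (v @ u)"
proof -
  have "pres_eq R (u @ v @ (inv_word (v @ u) @ (v @ u))) (u @ v)"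
    using pres_eq_context[OF pres_eq_inv_word_left, of R "u @ v" "v @ u" "[]"] by simp
  moreover have "pres_eq R (comm_word u v @ (v @ u)) (v @ u)"
    using pres_eq.relator[OF assms, of "[]" "v @ u"] by simp
  ultimately show ?thesis
    by (simp add: comm_word_def inv_word_append) (blast intro: pres_eq.sym pres_eq.trans)
qed

lemma inv_pres_class_letter:
  "inv\<^bsub>presented_group R\<^esub> pres_class R [(x, b)] = pres_class R [(x, \<not> b)]"
proof -
  interpret group "presented_group R" by (rule group_presented_group)
  have "pres_eq R [(x, \<not> b), (x, b)] []"
    using pres_eq.cancel[of R "[]" x "\<not> b" "[]"] by simp
  then show ?thesis
    by (intro inv_equality)
      (auto simp: presented_group_mult presented_group_one pres_class_eq_iff
        presented_group_carrier)
qed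

lemma word_value_letters:
  "word_value (presented_group R) (map (\<lambda>l. pres_class R [l]) u) = pres_class R u"
  by (induction u) (simp_all add: word_value_def presented_group_one presented_group_mult)

section \<open>Walks of the lamplighter\<close>

lemma sym_alphabet_lamplighter:
  "sym_alphabet (lamplighter m) {lamp_a m, lamp_t m} = range (\<lambda>l. pres_class (lamp_relators m) [l])"
    (is "_ = range ?c")
proof -
  have "range ?c = ?c ` {(Gen_a, True), (Gen_a, False), (Gen_t, True), (Gen_t, False)}"
    by (rule arg_cong[of _ _ "image ?c"]) (auto intro: lamp_gen.exhaust)
  then show ?thesis
    by (auto simp: sym_alphabet_def lamplighter_def lamp_a_def lamp_t_def gen_pow_def
        inv_pres_class_letter)
qed

text \<open>Lifts a word in group elements to a formal word, on which cursor and lamps can be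
  computed by recursion. The lift need not be unique: for \<open>m = 2\<close> the letters for a and
  its inverse coincide.\<close>

lemma lamplighter_letters:
  assumes "w \<in> lists (sym_alphabet (lamplighter m) {lamp_a m, lamp_t m})"
  obtains u where "w = map (\<lambda>l. pres_class (lamp_relators m) [l]) u"
  using assms unfolding sym_alphabet_lamplighter lists_image by auto

lemma word_length_lamplighter_le:
  "word_length (lamplighter m) {lamp_a m, lamp_t m} (pres_class (lamp_relators m) u) \<le> length u"
  unfolding word_length_def
proof (rule Least_le, rule bexI)
  let ?w = "map (\<lambda>l. pres_class (lamp_relators m) [l]) u"
  show "word_value (lamplighter m) ?w = pres_class (lamp_relators m) u \<and> length ?w = length u"
    by (simp add: lamplighter_def word_value_letters)
  show "?w \<in> lists (sym_alphabet (lamplighter m) {lamp_a m, lamp_t m})"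
    by (auto simp: sym_alphabet_lamplighter)
qed

section \<open>Cursor and lamps as invariants of the group element\<close>

definition letter_sign :: "bool \<Rightarrow> int" where
  "letter_sign b = (if b then 1 else - 1)"

fun cursor :: "lamp_gen gword \<Rightarrow> int" where
  "cursor [] = 0"
| "cursor ((Gen_a, b) # u) = cursor u"
| "cursor ((Gen_t, b) # u) = letter_sign b + cursor u"

text \<open>The lamp state is an integer here; in the group it only matters modulo \<open>m\<close>.\<close>

fun lamp :: "lamp_gen gword \<Rightarrow> int \<Rightarrow> int" where
  "lamp [] i = 0"
| "lamp ((Gen_a, b) # u) i = (if i = 0 then letter_sign b else 0) + lamp u i"
| "lamp ((Gen_t, b) # u) i = lamp u (i - letter_sign b)"

lemma letter_sign_not [simp]: "letter_sign (\<not> b) = - letter_sign b"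
  by (simp add: letter_sign_def)

lemma cursor_append: "cursor (u @ v) = cursor u + cursor v"
  by (induction u rule: cursor.induct) simp_all

text \<open>The multiplication law of the wreath product: the second walk starts at
  \<open>cursor u\<close>, so its lamps are shifted by that amount.\<close>

lemma lamp_append: "lamp (u @ v) i = lamp u i + lamp v (i - cursor u)"
  by (induction u i rule: lamp.induct) (simp_all add: algebra_simps)

lemma cursor_inv_word: "cursor (inv_word u) = - cursor u"
  by (induction u rule: cursor.induct) (simp_all add: inv_word_def cursor_append)

lemma lamp_inv_word: "lamp (inv_word u) i = - lamp u (i + cursor u)"
proof (induction u arbitrary: i rule: cursor.induct)
  case (2 b u)
  then show ?case
    using cursor_inv_word[of u] by (simp add: inv_word_def lamp_append)
next
  case (3 b u)
  then show ?case
    using cursor_inv_word[of u] by (simp add: inv_word_def lamp_append algebra_simps)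
qed (simp add: inv_word_def)

lemma cursor_replicate_t [simp]: "cursor (replicate n (Gen_t, b)) = int n * letter_sign b"
  by (induction n) (simp_all add: algebra_simps)

lemma lamp_replicate_t [simp]: "lamp (replicate n (Gen_t, b)) i = 0"
  by (induction n arbitrary: i) simp_all

lemma cursor_replicate_a [simp]: "cursor (replicate n (Gen_a, b)) = 0"
  by (induction n) simp_all

lemma lamp_replicate_a [simp]:
  "lamp (replicate n (Gen_a, b)) i = (if i = 0 then int n * letter_sign b else 0)"
  by (induction n) (simp_all add: algebra_simps)

lemma cursor_lamp_conj: "cursor (lamp_conj i) = 0"
  by (simp add: lamp_conj_def gen_pow_def cursor_append letter_sign_def)

text \<open>The conjugates of a have cursor 0, so the lamps of their commutators cancel without any
  shift; the power of a adds \<open>m\<close> to the lamp at the origin.\<close>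

lemma lamp_relators_neutral:
  assumes "r \<in> lamp_relators m"
  shows "cursor r = 0" and "int m dvd lamp r i"
  using assms
  by (auto simp: lamp_relators_def comm_word_def gen_pow_def cursor_append lamp_append
      cursor_inv_word lamp_inv_word cursor_lamp_conj letter_sign_def)

lemma pres_eq_lamplighter_invariants:
  assumes "pres_eq (lamp_relators m) u v"
  shows "cursor u = cursor v \<and> (\<forall>i. lamp u i mod int m = lamp v i mod int m)"
  using assms
proof (induction rule: pres_eq.induct)
  case (cancel u x b v)
  then show ?case
    by (cases x) (auto simp: cursor_append lamp_append)
next
  case (relator r u v)
  have "lamp (u @ r @ v) i mod int m = lamp (u @ v) i mod int m" for i
    using lamp_relators_neutral(1)[OF relator] lamp_relators_neutral(2)[OF relator, of "i - cursor u"]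
    by (auto simp: lamp_append mod_eq_dvd_iff)
  then show ?case
    using lamp_relators_neutral(1)[OF relator] by (simp add: cursor_append)
qed auto

section \<open>Lower bounds for the length of a walk\<close>

lemma abs_cursor_le: "\<bar>cursor u\<bar> \<le> int (length u)"
  by (induction u rule: cursor.induct) (auto simp: letter_sign_def)

text \<open>A letter moves the cursor by at most one, so equality in \<open>abs_cursor_le\<close>
  leaves no room for a press or a move the other way.\<close>

lemma cursor_extremal:
  assumes "cursor u * letter_sign b = int (length u)"
  shows "u = replicate (length u) (Gen_t, b)"
  using assms
proof (induction u rule: cursor.induct)
  case (2 c u)
  then show ?case
    using abs_cursor_le[of u] by (auto simp: letter_sign_def split: if_splits)
next
  case (3 c u)
  then show ?case
    using abs_cursor_le[of u] by (auto simp: letter_sign_def split: if_splits)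
qed simp

lemma lamp_lit_visit:
  assumes "lamp u i \<noteq> 0"
  obtains k b where "k < length u" "u ! k = (Gen_a, b)" "cursor (take k u) = i"
  using assms
proof (induction u i arbitrary: thesis rule: lamp.induct)
  case (1 i)
  then show ?case by simp
next
  case (2 b u i)
  show ?case
  proof (cases "i = 0")
    case True
    then show ?thesis using 2(2)[of 0 b] by simp
  next
    case False
    then have "lamp u i \<noteq> 0" using 2(3) by simp
    then obtain k c where "k < length u" "u ! k = (Gen_a, c)" "cursor (take k u) = i"
      using 2(1) by blast
    then show ?thesis using 2(2)[of "Suc k" c] by simp
  qed
next
  case (3 b u i)
  then have "lamp u (i - letter_sign b) \<noteq> 0" by simp
  then obtain k c where "k < length u" "u ! k = (Gen_a, c)" "cursor (take k u) = i - letter_sign b"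
    using 3(1) by blast
  then show ?case using 3(2)[of "Suc k" c] by simp
qed

text \<open>The two presses cut the walk into three parts with displacements of size n, 2n and n.
  Together with the presses these already use up the allowed length, so no part makes a detour, in
  particular not the first.\<close>

lemma walk_two_lamps:
  assumes "k < l" "l < length u" "u ! k = (Gen_a, c)" "u ! l = (Gen_a, d)"
    and "cursor (take k u) = int n * letter_sign b"
    and "cursor (take l u) = - (int n * letter_sign b)"
    and "cursor u = 0" "length u \<le> 4 * n + 2"
  shows "length u = 4 * n + 2" "take n u = replicate n (Gen_t, b)"
proof -
  define u1 u2 u3 where "u1 = take k u" "u2 = drop (Suc k) (take l u)" "u3 = drop (Suc l) u"
  have "take l u = take k (take l u) @ take l u ! k # drop (Suc k) (take l u)"
    using assms(1,2) by (intro id_take_nth_drop) simp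
  also have "\<dots> = u1 @ (Gen_a, c) # u2"
    using assms(1-3) by (simp add: u1_u2_u3_def min_def)
  finally have l: "take l u = u1 @ (Gen_a, c) # u2" .
  have "u = take l u @ u ! l # drop (Suc l) u"
    using assms(2) by (rule id_take_nth_drop)
  also have "\<dots> = u1 @ (Gen_a, c) # u2 @ (Gen_a, d) # u3"
    using assms(4) by (simp add: l u1_u2_u3_def(3))
  finally have u: "u = u1 @ (Gen_a, c) # u2 @ (Gen_a, d) # u3" .
  have c1: "cursor u1 = int n * letter_sign b"
    using assms(5) by (simp add: u1_u2_u3_def)
  moreover have c2: "cursor u2 = - 2 * (int n * letter_sign b)"
    using assms(6) c1 by (simp add: l cursor_append)
  moreover have c3: "cursor u3 = int n * letter_sign b"
    using assms(7) c1 c2 by (simp add: u cursor_append)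
  ultimately have "int n \<le> int (length u1)" "2 * int n \<le> int (length u2)" "int n \<le> int (length u3)"
    using abs_cursor_le[of u1] abs_cursor_le[of u2] abs_cursor_le[of u3]
    by (auto simp: letter_sign_def split: if_splits)
  moreover have "length u = length u1 + length u2 + length u3 + 2"
    using arg_cong[OF u, of length] by simp
  \<comment> \<open>The lower bounds add up to the assumed upper bound, hence each of them is
    attained.\<close>
  ultimately have n: "length u1 = n" and len: "length u = 4 * n + 2"
    using assms(8) by linarith+
  have "u1 = replicate n (Gen_t, b)"
    using cursor_extremal[of u1 b] c1 n by (simp add: letter_sign_def split: if_splits)
  then show "take n u = replicate n (Gen_t, b)"
    using n u by (metis append_eq_conv_conj)
  show "length u = 4 * n + 2" by (rule len)
qed

section \<open>Two opposite lamps\<close>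

text \<open>The sign \<open>b\<close> selects which of the two lamps is visited first.\<close>

definition opposite_lamps :: "nat \<Rightarrow> bool \<Rightarrow> lamp_gen gword" where
  "opposite_lamps n b = replicate n (Gen_t, b) @ [(Gen_a, True)] @ replicate (2 * n) (Gen_t, \<not> b) @
    [(Gen_a, True)] @ replicate n (Gen_t, b)"

lemma length_opposite_lamps: "length (opposite_lamps n b) = 4 * n + 2"
  by (simp add: opposite_lamps_def)

text \<open>The middle block of length 2n joins the end of one conjugate to the start of the other,
  so changing the visiting order swaps two commuting factors.\<close>

lemma opposite_lamps_conj:
  assumes "n > 0"
  shows "opposite_lamps n True = lamp_conj (int n) @ lamp_conj (- int n)"
    and "opposite_lamps n False = lamp_conj (- int n) @ lamp_conj (int n)"
  using assms
  by (simp_all add: opposite_lamps_def lamp_conj_def gen_pow_def mult_2 replicate_add)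

lemma pres_eq_opposite_lamps:
  assumes "n > 0"
  shows "pres_eq (lamp_relators m) (opposite_lamps n b) (opposite_lamps n c)"
proof -
  have "comm_word (lamp_conj (int n)) (lamp_conj (- int n)) \<in> lamp_relators m"
    by (auto simp: lamp_relators_def)
  then have "pres_eq (lamp_relators m) (opposite_lamps n True) (opposite_lamps n False)"
    unfolding opposite_lamps_conj[OF assms] by (rule pres_eq_commute)
  then show ?thesis
    by (cases b; cases c) (auto intro: pres_eq.refl pres_eq.sym)
qed

lemma opposite_lamps_walk:
  assumes m: "m \<ge> 2" and n: "n > 0"
    and eq: "pres_eq (lamp_relators m) u (opposite_lamps n True)"
    and len: "length u \<le> 4 * n + 2"
  obtains b where "length u = 4 * n + 2" "take n u = replicate n (Gen_t, b)"
proof -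
  have cur: "cursor u = 0"
    using pres_eq_lamplighter_invariants[OF eq]
    by (simp add: opposite_lamps_def cursor_append letter_sign_def)
  have lit: "lamp u (int n) \<noteq> 0" "lamp u (- int n) \<noteq> 0"
  proof -
    have "lamp (opposite_lamps n True) (int n) = 1" "lamp (opposite_lamps n True) (- int n) = 1"
      using n by (simp_all add: opposite_lamps_def lamp_append cursor_append letter_sign_def)
    \<comment> \<open>Here \<open>m \<ge> 2\<close> matters: 1 is its own residue and differs from
      0.\<close>
    then have "lamp u (int n) mod int m = 1" "lamp u (- int n) mod int m = 1"
      using pres_eq_lamplighter_invariants[OF eq] m by simp_all
    then show "lamp u (int n) \<noteq> 0" "lamp u (- int n) \<noteq> 0" by auto
  qed
  obtain k c where k: "k < length u" "u ! k = (Gen_a, c)" "cursor (take k u) = int n"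
    using lamp_lit_visit[OF lit(1)] by blast
  obtain l d where l: "l < length u" "u ! l = (Gen_a, d)" "cursor (take l u) = - int n"
    using lamp_lit_visit[OF lit(2)] by blast
  have "k \<noteq> l" using k(3) l(3) n by auto
  then consider "k < l" | "l < k" by linarith
  then show thesis
  proof cases
    case 1
    show thesis
      using walk_two_lamps[OF 1 l(1) k(2) l(2), of n True] k(3) l(3) cur len
      by (intro that[of True]) (simp_all add: letter_sign_def)
  next
    case 2
    show thesis
      using walk_two_lamps[OF 2 k(1) l(2) k(2), of n False] k(3) l(3) cur len
      by (intro that[of False]) (simp_all add: letter_sign_def)
  qed
qed

text \<open>The order of visits can be chosen so that the walk first runs back along the prefix; n
  letters then cancel against n letters of the prefix, which needs \<open>k \<ge> n\<close>.\<close>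

lemma shortened_opposite_lamps:
  assumes "n > 0" "k \<ge> n" and eq: "pres_eq (lamp_relators m) u (opposite_lamps n True)"
  obtains v where "pres_eq (lamp_relators m) (replicate k (Gen_t, b) @ u) v"
    "length v = k + 2 * n + 2"
proof
  let ?t = "\<lambda>j c. replicate j (Gen_t, c)"
  let ?rest = "[(Gen_a, True)] @ ?t (2 * n) b @ [(Gen_a, True)] @ ?t n (\<not> b)"
  have "pres_eq (lamp_relators m) u (opposite_lamps n (\<not> b))"
    by (rule pres_eq.trans[OF eq pres_eq_opposite_lamps[OF assms(1)]])
  then have "pres_eq (lamp_relators m) (?t k b @ u) (?t k b @ opposite_lamps n (\<not> b))"
    by (rule pres_eq_append[OF pres_eq.refl])
  also have "?t k b @ opposite_lamps n (\<not> b) = ?t (k - n) b @ (?t n b @ ?t n (\<not> b)) @ ?rest"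
    using replicate_add[of "k - n" n "(Gen_t, b)"] assms(2) by (simp add: opposite_lamps_def)
  finally show "pres_eq (lamp_relators m) (?t k b @ u) (?t (k - n) b @ ?rest)"
    using pres_eq_context[OF pres_eq_replicate_cancel, of "lamp_relators m" "?t (k - n) b" n Gen_t b ?rest]
    by (auto intro: pres_eq.trans)
  show "length (?t (k - n) b @ ?rest) = k + 2 * n + 2"
    using assms(2) by simp
qed

section \<open>Pumping\<close>

lemma foldl_replicate_pump:
  assumes "foldl f s (replicate j x) = foldl f s (replicate i x)" "i \<le> j"
  shows "foldl f s (replicate (i + r * (j - i)) x) = foldl f s (replicate i x)"
proof (induction r)
  case (Suc r)
  have "i + Suc r * (j - i) = j + r * (j - i)"
    using assms(2) by simp
  then show ?case
    using Suc by (simp add: replicate_add assms(1))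
qed simp

text \<open>Pumping inside an initial block of one repeated letter; since all its letters agree, the
  extra copies may be written at the front.\<close>

lemma regular_language_pump:
  assumes "regular_language A L"
  obtains n where "n > 0"
    "\<And>x v. replicate n x @ v \<in> L \<Longrightarrow> \<exists>q>0. \<forall>r. replicate (r * q) x @ replicate n x @ v \<in> L"
proof -
  obtain M :: "(nat, 'a) automaton" where M: "finite_state_automaton A M"
    and L: "L = accepted_language A M"
    using assms by (auto simp: regular_language_def)
  let ?n = "card (states M)"
  have fin: "finite (states M)" and ne: "states M \<noteq> {}"
    using M by (auto simp: finite_state_automaton_def)
  have "\<exists>q>0. \<forall>r. replicate (r * q) x @ replicate ?n x @ v \<in> L"
    if w: "replicate ?n x @ v \<in> L" for x v
  proof -
    \<comment> \<open>The block is nonempty because there is at least one state, so \<open>x\<close>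
      really occurs in the accepted word.\<close>
    have x: "x \<in> A"
      using w fin ne by (auto simp: L accepted_language_def card_gt_0_iff)
    define \<delta> where "\<delta> i = foldl (step M) (start M) (replicate i x)" for i
    have "\<delta> i \<in> states M" for i
      by (induction i)
        (use M x in \<open>auto simp: \<delta>_def finite_state_automaton_def simp flip: replicate_append_same\<close>)
    then have "card (\<delta> ` {..?n}) \<le> ?n"
      by (intro card_mono fin) auto
    \<comment> \<open>The exponents from 0 to \<open>?n\<close> are one more than the states
      available.\<close>
    then have "\<not> inj_on \<delta> {..?n}"
      by (intro pigeonhole) simp
    then obtain i j where ij: "i < j" "j \<le> ?n" "\<delta> i = \<delta> j"
      unfolding inj_on_def by (metis atMost_iff linorder_neqE_nat)
    have "replicate (r * (j - i)) x @ replicate ?n x @ v \<in> L" for r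
    proof -
      have split: "replicate (p + (i + (?n - i))) x = replicate p x @ replicate ?n x" for p
        using ij by (simp add: replicate_add)
      have "\<delta> (i + r * (j - i)) = \<delta> i"
        using foldl_replicate_pump[of "step M" "start M" j x i r] ij by (simp add: \<delta>_def)
      then have "foldl (step M) (start M) (replicate (i + r * (j - i)) x @ replicate (?n - i) x @ v)
          = foldl (step M) (start M) (replicate i x @ replicate (?n - i) x @ v)"
        by (simp add: \<delta>_def)
      moreover have "replicate (i + r * (j - i)) x @ replicate (?n - i) x
          = replicate (r * (j - i)) x @ replicate ?n x"
        using split[of "r * (j - i)"] by (simp add: add_ac flip: replicate_add)
      moreover have "replicate i x @ replicate (?n - i) x = replicate ?n x"
        using ij by (simp flip: replicate_add)
      ultimately have "foldl (step M) (start M) (replicate (r * (j - i)) x @ replicate ?n x @ v)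
          = foldl (step M) (start M) (replicate ?n x @ v)"
        by (metis append_assoc)
      then show ?thesis
        using w x by (auto simp: L accepted_language_def)
    qed
    then show ?thesis
      using ij(1) by (intro exI[of _ "j - i"]) simp
  qed
  moreover have "?n > 0"
    using fin ne by (simp add: card_gt_0_iff)
  ultimately show thesis
    using that by blast
qed

theorem theorem15:
  fixes m :: nat
  assumes "m \<ge> 2"
  shows "\<not> (\<exists>L. language_of_geodesics (lamplighter m) {lamp_a m, lamp_t m} L \<and>
    regular_language (sym_alphabet (lamplighter m) {lamp_a m, lamp_t m}) L)"
proof
  let ?X = "{lamp_a m, lamp_t m}" and ?R = "lamp_relators m"
  let ?c = "\<lambda>l. pres_class ?R [l]"
  assume "\<exists>L. language_of_geodesics (lamplighter m) ?X L \<and>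
    regular_language (sym_alphabet (lamplighter m) ?X) L"
  then obtain L where L: "language_of_geodesics (lamplighter m) ?X L"
    and reg: "regular_language (sym_alphabet (lamplighter m) ?X) L"
    by blast
  obtain n where n: "n > 0" and pump:
    "\<And>x v. replicate n x @ v \<in> L \<Longrightarrow> \<exists>q>0. \<forall>r. replicate (r * q) x @ replicate n x @ v \<in> L"
    using regular_language_pump[OF reg] by blast
  \<comment> \<open>Geodesicity restated for formal words: an accepted word is no longer than any
    formal word for the same element.\<close>
  have geodesic: "length u \<le> length v" if "map ?c u \<in> L" "pres_eq ?R u v" for u v
  proof -
    have "length (map ?c u) = word_length (lamplighter m) ?X (word_value (lamplighter m) (map ?c u))"
      using L that(1) unfolding language_of_geodesics_def geodesic_word_def by blast
    also have "word_value (lamplighter m) (map ?c u) = pres_class ?R v"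
      using that(2) by (simp add: lamplighter_def word_value_letters pres_class_eq_iff)
    finally show ?thesis
      using word_length_lamplighter_le[of m v] by simp
  qed
  have "pres_class ?R (opposite_lamps n True) \<in> carrier (lamplighter m)"
    by (simp add: lamplighter_def presented_group_carrier)
  then obtain w where w: "w \<in> L"
    "word_value (lamplighter m) w = pres_class ?R (opposite_lamps n True)"
    using L unfolding language_of_geodesics_def by blast
  have "w \<in> lists (sym_alphabet (lamplighter m) ?X)"
    using L w(1) unfolding language_of_geodesics_def geodesic_word_def by blast
  then obtain u where u: "w = map ?c u"
    by (rule lamplighter_letters)
  have eq: "pres_eq ?R u (opposite_lamps n True)"
    using w(2) by (simp add: u lamplighter_def word_value_letters pres_class_eq_iff)
  have "length u \<le> 4 * n + 2"
    using geodesic[OF _ eq] w(1) by (simp add: u length_opposite_lamps)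
  then obtain b where len: "length u = 4 * n + 2" and b: "take n u = replicate n (Gen_t, b)"
    using opposite_lamps_walk[OF assms n eq] by blast
  have uv: "u = replicate n (Gen_t, b) @ drop n u"
    by (metis append_take_drop_id b)
  then have "w = replicate n (?c (Gen_t, b)) @ map ?c (drop n u)"
    unfolding u by (metis map_append map_replicate)
  then obtain q where q: "q > 0" and
    "\<forall>r. replicate (r * q) (?c (Gen_t, b)) @ w \<in> L"
    using pump w(1) by metis
  \<comment> \<open>Taking \<open>r = n\<close> makes the added exponent \<open>n * q\<close> at
    least \<open>n\<close>, enough for the cancellation.\<close>
  then have pumped: "map ?c (replicate (n * q) (Gen_t, b) @ u) \<in> L"
    by (simp add: u)
  have "n * q \<ge> n" using q by simp
  then obtain v where v: "pres_eq ?R (replicate (n * q) (Gen_t, b) @ u) v"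
    "length v = n * q + 2 * n + 2"
    using shortened_opposite_lamps[OF n _ eq] by blast
  \<comment> \<open>The accepted word has length \<open>n * q + 4 * n + 2\<close>, which exceeds
    that of \<open>v\<close> by \<open>2 * n\<close>.\<close>
  from geodesic[OF pumped v(1)] show False
    using n by (simp add: len v(2))
qed

end
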